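(* Let $M_1,M_2$ be two closed subspaces of a complex Hilbert space $H\neq\{0\}$ and let $\alpha\in[\frac{\pi}{3},\pi]$. The following assertions are equivalent: 1. $\frac{1}{2(1-\cos(\alpha))}\in\sigma(P_{M_2}P_{M_1})$; 2. $\sup\{\mathrm{Re}(z e^{-i\alpha}) : z\in W(P_{M_2}P_{M_1})\}=\frac{1}{4(1-\cos(\alpha))}$.
   Context: For a closed subspace $M$ of $H$, $P_M$ denotes the orthogonal projection of $H$ onto $M$. For a bounded operator $T$ on $H$, $\sigma(T)$ is its spectrum and $W(T)=\{\langle Tx,x\rangle : x\in H,\ \|x\|=1\}$ is its numerical range. *)

theory Defs
  imports "HOL-Analysis.Analysis"
begin

class complex_vector = real_vector +
  fixes scaleC :: "complex \<Rightarrow> 'a \<Rightarrow> 'a" (infixr "*\<^sub>C" 75)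
  assumes scaleC_add_right: "c *\<^sub>C (x + y) = c *\<^sub>C x + c *\<^sub>C y"
    and scaleC_add_left: "(c + d) *\<^sub>C x = c *\<^sub>C x + d *\<^sub>C x"
    and scaleC_scaleC: "c *\<^sub>C (d *\<^sub>C x) = (c * d) *\<^sub>C x"
    and scaleC_one: "1 *\<^sub>C x = x"
    and scaleR_scaleC: "r *\<^sub>R x = complex_of_real r *\<^sub>C x"

global_interpretation complex_vector: vector_space "scaleC :: complex \<Rightarrow> 'a \<Rightarrow> 'a::complex_vector"
  by unfold_locales (simp_all add: scaleC_add_right scaleC_add_left scaleC_scaleC scaleC_one)

text \<open>
  The inner product is linear in the first argument. Its real part is required to be the
  real inner product of the underlying real inner product space; together with the axioms of
  \<^class>\<open>real_inner\<close> this says that it is positive definite and induces the norm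
  and the topology of the type.
\<close>

class complex_inner = complex_vector + real_inner +
  fixes cinner :: "'a \<Rightarrow> 'a \<Rightarrow> complex"
  assumes cinner_commute: "cinner x y = cnj (cinner y x)"
    and cinner_add_left: "cinner (x + y) z = cinner x z + cinner y z"
    and cinner_scaleC_left: "cinner (c *\<^sub>C x) y = c * cinner x y"
    and inner_eq_Re_cinner: "inner x y = Re (cinner x y)"

class complex_hilbert_space = complex_inner + complete_space

definition closed_csubspace :: "'a::complex_inner set \<Rightarrow> bool" where
  "closed_csubspace M \<longleftrightarrow> complex_vector.subspace M \<and> closed M"

definition bounded_clinear :: "('a::complex_inner \<Rightarrow> 'a) \<Rightarrow> bool" where
  "bounded_clinear T \<longleftrightarrow> bounded_linear T \<and> (\<forall>c x. T (c *\<^sub>C x) = c *\<^sub>C T x)"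

text \<open>
  For a closed subspace of a complex Hilbert space, the projection theorem guarantees that the
  described point exists; it is always unique.
\<close>

definition orth_proj :: "'a::complex_inner set \<Rightarrow> 'a \<Rightarrow> 'a" where
  "orth_proj M x = (THE p. p \<in> M \<and> (\<forall>m\<in>M. cinner (x - p) m = 0))"

text \<open>
  Invertibility is in the algebra of bounded complex-linear operators on the whole space.
\<close>

definition spectrum :: "('a::complex_inner \<Rightarrow> 'a) \<Rightarrow> complex set" where
  "spectrum T = {z. \<not> (\<exists>S. bounded_clinear S \<and>
     (\<forall>x. S (T x - z *\<^sub>C x) = x) \<and> (\<forall>x. T (S x) - z *\<^sub>C S x = x))}"

definition numerical_range :: "('a::complex_inner \<Rightarrow> 'a) \<Rightarrow> complex set" where
  "numerical_range T = {cinner (T x) x | x. norm x = 1}"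

end

theory Submission
  imports Defs
begin

text \<open>
  Write \<open>P\<close> and \<open>Q\<close> for the projections onto \<open>M\<^sub>1\<close> and \<open>M\<^sub>2\<close>, put \<open>\<mu> = 1 - exp (- \<i> \<alpha>)\<close>, so that
  \<open>\<bar>\<mu>\<bar>\<^sup>2 = 2 (1 - cos \<alpha>)\<close>, and let \<open>\<lambda> = 1 / \<bar>\<mu>\<bar>\<^sup>2\<close> be the number in the first assertion. Everything
  rests on one operator, \<open>A x = x - \<mu> P x - cnj \<mu> Q x\<close>, called the pencil of \<open>P\<close> and \<open>Q\<close> below.

  Since \<open>\<mu>\<close> lies on the unit circle around 1, the terms in \<open>\<parallel>P x\<parallel>\<^sup>2\<close> and \<open>\<parallel>Q x\<parallel>\<^sup>2\<close> cancel in the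
  expansion of \<open>\<parallel>A x\<parallel>\<^sup>2\<close>, and only the mixed term survives
  (lemma \<open>pencil_identity\<close>). As \<open>\<mu>\<^sup>2 = - 2 (1 - cos \<alpha>) exp (- \<i> \<alpha>)\<close>, this reads
  \<open>\<parallel>A x\<parallel>\<^sup>2 = \<parallel>x\<parallel>\<^sup>2 - 4 (1 - cos \<alpha>) Re (exp (- \<i> \<alpha>) \<langle>Q P x, x\<rangle>)\<close>.
  Hence the supremum over the numerical range is always at most \<open>1 / (4 (1 - cos \<alpha>))\<close>, with
  equality exactly when \<open>A\<close> is not bounded below.

  It remains to see that \<open>A\<close> is bounded below exactly when \<open>\<lambda>\<close> lies outside the spectrum of \<open>Q P\<close>.
  If \<open>A x\<close> is small, applying \<open>P\<close> and \<open>Q\<close> to \<open>x \<approx> \<mu> P x + cnj \<mu> Q x\<close> shows that \<open>Q x\<close> is an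
  approximate eigenvector of \<open>Q P\<close> for \<open>\<lambda>\<close>
  (lemma \<open>pencil_bounded_below_if_not_in_spectrum\<close>). Conversely an approximate eigenvector in
  \<open>M\<^sub>2\<close> yields a vector on which \<open>A\<close> is small; so a lower bound for \<open>A\<close> gives one for the
  self-adjoint operator \<open>Q P Q - \<lambda>\<close>, which is therefore invertible, and invertibility passes from
  \<open>(Q P) Q - \<lambda>\<close> to \<open>Q (Q P) - \<lambda> = Q P - \<lambda>\<close>
  (lemma \<open>not_in_spectrum_if_pencil_bounded_below\<close>).
\<close>

section \<open>Orthogonal decomposition\<close>

text \<open>
  A sequence in \<open>M\<close> whose distances to \<open>x\<close> approach the infimum is Cauchy by the parallelogram law,
  because midpoints stay in \<open>M\<close>. Its limit is a nearest point, and moving from it in a direction of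
  \<open>M\<close> cannot shorten the distance, which forces orthogonality.
\<close>
lemma orth_decomposition_exists:
  fixes M :: "'a::{real_inner, complete_space} set"
  assumes "subspace M" "closed M"
  shows "\<exists>p\<in>M. \<forall>m\<in>M. inner (x - p) m = 0"
proof -
  define d where "d = (INF m\<in>M. (norm (x - m))\<^sup>2)"
  have M0: "0 \<in> M" using assms(1) by (rule subspace_0)
  have bdd: "bdd_below ((\<lambda>m. (norm (x - m))\<^sup>2) ` M)"
    by (rule bdd_belowI[of _ 0]) auto
  have d_le: "d \<le> (norm (x - m))\<^sup>2" if "m \<in> M" for m
    unfolding d_def using bdd that by (rule cINF_lower)
  have "\<exists>m\<in>M. (norm (x - m))\<^sup>2 < d + 1 / (real n + 1)" for n
  proof -
    have "(INF m\<in>M. (norm (x - m))\<^sup>2) < d + 1 / (real n + 1)"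
      unfolding d_def by simp
    then show ?thesis
      using cINF_less_iff[OF _ bdd] M0 by blast
  qed
  then obtain m where mM: "\<And>n. m n \<in> M"
    and m_lt: "\<And>n. (norm (x - m n))\<^sup>2 < d + 1 / (real n + 1)" by metis
  have close: "(norm (m i - m j))\<^sup>2 \<le> 2 / (real i + 1) + 2 / (real j + 1)" for i j
  proof -
    have "(1 / 2) *\<^sub>R (m i + m j) \<in> M"
      by (intro subspace_scale subspace_add assms(1) mM)
    from d_le[OF this] have "d \<le> (norm (x - (1 / 2) *\<^sub>R (m i + m j)))\<^sup>2" .
    moreover have "(norm (m i - m j))\<^sup>2 + 4 * (norm (x - (1 / 2) *\<^sub>R (m i + m j)))\<^sup>2
        = 2 * (norm (x - m i))\<^sup>2 + 2 * (norm (x - m j))\<^sup>2"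
      unfolding power2_norm_eq_inner
      by (simp add: inner_diff_left inner_diff_right inner_add_left inner_add_right
          inner_commute algebra_simps)
    ultimately show ?thesis using m_lt[of i] m_lt[of j] by simp
  qed
  have "Cauchy m"
  proof (rule metric_CauchyI)
    fix e :: real assume e: "0 < e"
    obtain k :: nat where k: "4 / e\<^sup>2 < real k" using reals_Archimedean2 by blast
    have "dist (m i) (m j) < e" if ij: "i \<ge> k" "j \<ge> k" for i j
    proof -
      have k0: "real k > 0" using k e by (smt (verit) divide_pos_pos zero_less_power)
      have "2 / (real i + 1) \<le> 2 / (real k + 1)" "2 / (real j + 1) \<le> 2 / (real k + 1)"
        using ij by (auto intro!: divide_left_mono)
      then have "(norm (m i - m j))\<^sup>2 \<le> 4 / (real k + 1)" using close[of i j] by simp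
      also have "\<dots> < 4 / real k" using k0 by (intro divide_strict_left_mono) auto
      also have "\<dots> < e\<^sup>2" using k k0 e by (simp add: field_simps)
      finally show ?thesis using e by (simp add: dist_norm power_less_imp_less_base)
    qed
    then show "\<exists>N. \<forall>i\<ge>N. \<forall>j\<ge>N. dist (m i) (m j) < e" by blast
  qed
  then obtain p where lim: "m \<longlonglongrightarrow> p" using Cauchy_convergent_iff convergent_def by blast
  have pM: "p \<in> M" using assms(2) mM lim by (rule closed_sequentially)
  have p_min: "(norm (x - p))\<^sup>2 \<le> d"
  proof (rule LIMSEQ_le)
    show "(\<lambda>n. (norm (x - m n))\<^sup>2) \<longlonglongrightarrow> (norm (x - p))\<^sup>2" by (intro tendsto_intros lim)
    have "(\<lambda>n. 1 / (real n + 1)) \<longlonglongrightarrow> 0"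
      using LIMSEQ_inverse_real_of_nat by (simp add: inverse_eq_divide add.commute)
    from tendsto_add[OF tendsto_const[of d] this]
    show "(\<lambda>n. d + 1 / (real n + 1)) \<longlonglongrightarrow> d" by simp
    show "\<exists>N. \<forall>n\<ge>N. (norm (x - m n))\<^sup>2 \<le> d + 1 / (real n + 1)"
      using m_lt less_imp_le by blast
  qed
  have "inner (x - p) y = 0" if y: "y \<in> M" for y
  proof (cases "y = 0")
    case False
    \<comment> \<open>The step \<open>t *\<^sub>R y\<close> would reach the point of the line through \<open>p\<close> that is nearest to \<open>x\<close>.\<close>
    define t where "t = inner (x - p) y / (norm y)\<^sup>2"
    have "p + t *\<^sub>R y \<in> M" by (intro subspace_add subspace_scale assms(1) pM y)
    from order_trans[OF p_min d_le[OF this]] have "(norm (x - p))\<^sup>2 \<le> (norm ((x - p) - t *\<^sub>R y))\<^sup>2"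
      by (simp add: algebra_simps)
    also have "\<dots> = (norm (x - p))\<^sup>2 - 2 * t * inner (x - p) y + t\<^sup>2 * (norm y)\<^sup>2"
      unfolding power2_norm_eq_inner
      by (simp add: inner_diff_left inner_diff_right inner_commute power2_eq_square algebra_simps)
    also have "\<dots> = (norm (x - p))\<^sup>2 - (inner (x - p) y)\<^sup>2 / (norm y)\<^sup>2"
      using False by (simp add: t_def field_simps power2_eq_square)
    finally have "(inner (x - p) y)\<^sup>2 / (norm y)\<^sup>2 \<le> 0" by simp
    then show ?thesis using False by (simp add: divide_le_0_iff)
  qed simp
  with pM show ?thesis by blast
qed

section \<open>Complex inner products and bounded complex-linear operators\<close>

lemma cinner_scaleC_right: "cinner x (c *\<^sub>C y) = cnj c * cinner x (y::'a::complex_inner)"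
  by (subst (1 2) cinner_commute) (simp add: cinner_scaleC_left)

lemma cinner_add_right: "cinner x (y + z) = cinner x y + cinner x (z::'a::complex_inner)"
  by (subst (1 2 3) cinner_commute) (simp add: cinner_add_left)

lemma cinner_diff_left: "cinner (x - y) z = cinner x z - cinner y (z::'a::complex_inner)"
  using cinner_add_left[of "x - y" y z] by simp

lemma cinner_diff_right: "cinner x (y - z) = cinner x y - cinner x (z::'a::complex_inner)"
  using cinner_add_right[of x "y - z" z] by simp

lemma cinner_zero_left [simp]: "cinner 0 (x::'a::complex_inner) = 0"
  using cinner_diff_left[of x x x] by simp

lemma cinner_zero_right [simp]: "cinner (x::'a::complex_inner) 0 = 0"
  using cinner_diff_right[of x x x] by simp

lemma norm_power2_eq_Re_cinner: "(norm x)\<^sup>2 = Re (cinner x (x::'a::complex_inner))"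
  by (simp add: power2_norm_eq_inner inner_eq_Re_cinner)

lemma cinner_self: "cinner x x = complex_of_real ((norm (x::'a::complex_inner))\<^sup>2)"
proof -
  have "Im (cinner x x) = 0" using arg_cong[OF cinner_commute[of x x], of Im] by simp
  then show ?thesis by (simp add: complex_eq_iff norm_power2_eq_Re_cinner)
qed

lemma norm_scaleC: "norm (c *\<^sub>C x) = norm c * norm (x::'a::complex_inner)"
proof -
  have "cinner (c *\<^sub>C x) (c *\<^sub>C x) = complex_of_real ((norm c)\<^sup>2 * (norm x)\<^sup>2)"
    by (simp add: cinner_scaleC_left cinner_scaleC_right cinner_self[of x] complex_norm_square
        flip: of_real_power)
  then have "(norm (c *\<^sub>C x))\<^sup>2 = (norm c * norm x)\<^sup>2"
    by (simp add: norm_power2_eq_Re_cinner[of "c *\<^sub>C x"] power_mult_distrib flip: of_real_power of_real_mult)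
  then show ?thesis by (simp add: power2_eq_iff_nonneg)
qed

lemma bounded_clinearI:
  fixes T :: "'a::complex_inner \<Rightarrow> 'a"
  assumes "\<And>x y. T (x + y) = T x + T y" "\<And>c x. T (c *\<^sub>C x) = c *\<^sub>C T x"
    and "\<And>x. norm (T x) \<le> norm x * K"
  shows "bounded_clinear T"
  unfolding bounded_clinear_def
  using assms by (auto intro!: bounded_linear_intro[of T K] simp: scaleR_scaleC)

lemma bounded_clinear_add: "bounded_clinear T \<Longrightarrow> T (x + y) = T x + T y"
  and bounded_clinear_diff: "bounded_clinear T \<Longrightarrow> T (x - y) = T x - T y"
  and bounded_clinear_scaleC: "bounded_clinear T \<Longrightarrow> T (c *\<^sub>C x) = c *\<^sub>C T x"
  unfolding bounded_clinear_def
  by (simp_all add: bounded_linear.linear linear_add linear_diff)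

lemma bounded_clinear_compose:
  "bounded_clinear S \<Longrightarrow> bounded_clinear T \<Longrightarrow> bounded_clinear (\<lambda>x. S (T x))"
  unfolding bounded_clinear_def by (simp add: bounded_linear_compose[of S T])

lemma bounded_clinear_sub:
  "bounded_clinear S \<Longrightarrow> bounded_clinear T \<Longrightarrow> bounded_clinear (\<lambda>x. S x - T x)"
  unfolding bounded_clinear_def by (simp add: bounded_linear_sub complex_vector.scale_right_diff_distrib)

lemma bounded_clinear_scale:
  fixes T :: "'a::complex_inner \<Rightarrow> 'a"
  assumes T: "bounded_clinear T"
  shows "bounded_clinear (\<lambda>x. c *\<^sub>C T x)"
proof -
  obtain K where K: "\<And>x. norm (T x) \<le> norm x * K"
    using T unfolding bounded_clinear_def using bounded_linear.bounded by blast
  show ?thesis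
  proof (rule bounded_clinearI[of _ "norm c * K"])
    show "norm (c *\<^sub>C T x) \<le> norm x * (norm c * K)" for x
      using mult_left_mono[OF K[of x], of "norm c"] by (simp add: norm_scaleC mult_ac)
  qed (simp_all add: bounded_clinear_add[OF T] bounded_clinear_scaleC[OF T]
      scaleC_add_right scaleC_scaleC mult.commute)
qed

lemma bounded_clinear_ident: "bounded_clinear (\<lambda>x. x)"
  unfolding bounded_clinear_def by (simp add: bounded_linear_ident)

section \<open>Orthogonal projections\<close>

context
  fixes M :: "'a::complex_hilbert_space set"
  assumes M: "closed_csubspace M"
begin

text \<open>
  The real decomposition already suffices: orthogonality of the real parts to both \<open>m\<close> and \<open>\<i> *\<^sub>C m\<close>
  is complex orthogonality to \<open>m\<close>.
\<close>
lemma orth_proj_ex1: "\<exists>!p. p \<in> M \<and> (\<forall>m\<in>M. cinner (x - p) m = 0)"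
proof -
  have sub: "complex_vector.subspace M" and cl: "closed M"
    using M by (auto simp: closed_csubspace_def)
  have "subspace M"
    using sub unfolding subspace_def complex_vector.subspace_def by (simp add: scaleR_scaleC)
  then obtain p where p: "p \<in> M" "\<And>m. m \<in> M \<Longrightarrow> inner (x - p) m = 0"
    using orth_decomposition_exists[OF _ cl] by blast
  have p_orth: "cinner (x - p) m = 0" if m: "m \<in> M" for m
  proof -
    have "\<i> *\<^sub>C m \<in> M" using complex_vector.subspace_scale[OF sub m] .
    from p(2)[OF m] p(2)[OF this] show ?thesis
      by (simp add: inner_eq_Re_cinner cinner_scaleC_right complex_eq_iff)
  qed
  have "q = p" if q: "q \<in> M" "\<forall>m\<in>M. cinner (x - q) m = 0" for q
  proof -
    have qp: "q - p \<in> M" using complex_vector.subspace_diff[OF sub q(1) p(1)] .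
    have "cinner (q - p) (q - p) = cinner (x - p) (q - p) - cinner (x - q) (q - p)"
      by (simp flip: cinner_diff_left)
    also have "\<dots> = 0" using q(2) qp p_orth by simp
    finally show ?thesis by (simp add: cinner_self)
  qed
  then show ?thesis using p(1) p_orth by blast
qed

lemma orth_proj_in: "orth_proj M x \<in> M"
  and orth_proj_orth: "m \<in> M \<Longrightarrow> cinner (x - orth_proj M x) m = 0"
  using theI'[OF orth_proj_ex1[of x]] unfolding orth_proj_def by auto

lemma orth_proj_eqI: "p \<in> M \<Longrightarrow> (\<And>m. m \<in> M \<Longrightarrow> cinner (x - p) m = 0) \<Longrightarrow> orth_proj M x = p"
  unfolding orth_proj_def by (rule the1_equality[OF orth_proj_ex1]) blast

lemma orth_proj_fixes: "m \<in> M \<Longrightarrow> orth_proj M m = m"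
  by (rule orth_proj_eqI) simp_all

lemma orth_proj_idem: "orth_proj M (orth_proj M x) = orth_proj M x"
  by (intro orth_proj_fixes orth_proj_in)

lemma cinner_orth_proj: "cinner (orth_proj M x) y = cinner (orth_proj M x) (orth_proj M y)"
proof -
  have "cinner (y - orth_proj M y) (orth_proj M x) = 0"
    by (intro orth_proj_orth orth_proj_in)
  then have "cinner (orth_proj M x) (y - orth_proj M y) = 0"
    by (metis cinner_commute complex_cnj_zero)
  then show ?thesis by (simp add: cinner_diff_right)
qed

lemma orth_proj_self_adjoint: "cinner (orth_proj M x) y = cinner x (orth_proj M y)"
  using cinner_orth_proj[of x y] cinner_orth_proj[of y x]
    cinner_commute[of x "orth_proj M y"] cinner_commute[of "orth_proj M x" "orth_proj M y"]
  by simp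

lemma norm_orth_proj_pythagoras:
  "(norm x)\<^sup>2 = (norm (orth_proj M x))\<^sup>2 + (norm (x - orth_proj M x))\<^sup>2"
proof -
  have "cinner x (orth_proj M x) = cinner (orth_proj M x) (orth_proj M x)"
    using orth_proj_orth[OF orth_proj_in, of x x] by (simp add: cinner_diff_left)
  then show ?thesis
    unfolding norm_power2_eq_Re_cinner
    by (simp add: cinner_diff_left cinner_diff_right cinner_orth_proj[of x x])
qed

lemma norm_orth_proj_le: "norm (orth_proj M x) \<le> norm x"
  using norm_orth_proj_pythagoras[of x] by (simp add: power2_le_imp_le)

lemma bounded_clinear_orth_proj: "bounded_clinear (orth_proj M)"
proof (rule bounded_clinearI[of _ 1])
  have sub: "complex_vector.subspace M" using M by (simp add: closed_csubspace_def)
  show "orth_proj M (x + y) = orth_proj M x + orth_proj M y" for x y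
  proof (rule orth_proj_eqI)
    show "cinner (x + y - (orth_proj M x + orth_proj M y)) m = 0" if "m \<in> M" for m
      using orth_proj_orth[OF that, of x] orth_proj_orth[OF that, of y]
      by (simp add: cinner_diff_left cinner_add_left)
  qed (intro complex_vector.subspace_add[OF sub] orth_proj_in)
  show "orth_proj M (c *\<^sub>C x) = c *\<^sub>C orth_proj M x" for c x
  proof (rule orth_proj_eqI)
    show "cinner (c *\<^sub>C x - c *\<^sub>C orth_proj M x) m = 0" if "m \<in> M" for m
      using orth_proj_orth[OF that, of x]
      by (simp add: cinner_scaleC_left flip: complex_vector.scale_right_diff_distrib)
  qed (intro complex_vector.subspace_scale[OF sub] orth_proj_in)
qed (simp add: norm_orth_proj_le)

end

section \<open>Invertibility of self-adjoint operators\<close>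

text \<open>
  The lower bound makes the range complete, hence closed. For self-adjoint \<open>C\<close> a vector orthogonal to
  the range is in the kernel, so it vanishes, and the range is everything.
\<close>
lemma self_adjoint_bounded_below_invertible:
  fixes C :: "'a::complex_hilbert_space \<Rightarrow> 'a"
  assumes C: "bounded_clinear C"
    and adj: "\<And>x y. cinner (C x) y = cinner x (C y)"
    and \<delta>: "\<delta> > 0" "\<And>x. \<delta> * norm x \<le> norm (C x)"
  obtains R where "bounded_clinear R" "\<And>x. R (C x) = x" "\<And>x. C (R x) = x"
proof -
  note Cl = bounded_clinear_add[OF C] bounded_clinear_diff[OF C] bounded_clinear_scaleC[OF C]
  have inj: "x = y" if "C x = C y" for x y
    using \<delta>(2)[of "x - y"] \<delta>(1) that by (simp add: Cl mult_le_0_iff)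
  have "complete (C ` UNIV)"
    using \<delta> C complete_UNIV unfolding bounded_clinear_def
    by (intro complete_isometric_image[of \<delta>]) auto
  then have "closed (range C)" by (rule complete_imp_closed)
  moreover have "complex_vector.subspace (range C)"
    unfolding complex_vector.subspace_def
    using Cl(2)[of 0 0] by (auto simp: image_iff) (metis Cl(1), metis Cl(3))
  ultimately have cs: "closed_csubspace (range C)" by (simp add: closed_csubspace_def)
  have surj: "\<exists>x. C x = y" for y
  proof -
    define r where "r = y - orth_proj (range C) y"
    have "cinner (C r) (C r) = cinner r (C (C r))" by (rule adj)
    also have "\<dots> = 0" unfolding r_def by (intro orth_proj_orth[OF cs]) blast
    finally have "C r = 0" by (simp add: cinner_self)
    then have "r = 0" using \<delta>(1) \<delta>(2)[of r] by (simp add: mult_le_0_iff)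
    then show ?thesis using orth_proj_in[OF cs, of y] by (auto simp: r_def)
  qed
  then obtain R where R: "\<And>y. C (R y) = y" by metis
  show thesis
  proof (rule that)
    show "bounded_clinear R"
    proof (rule bounded_clinearI[of _ "1 / \<delta>"])
      show "norm (R x) \<le> norm x * (1 / \<delta>)" for x
        using \<delta>(2)[of "R x"] \<delta>(1) by (simp add: R field_simps)
    qed (rule inj, simp add: Cl R)+
  qed (rule inj, simp_all add: R)
qed

section \<open>The pencil of two projections\<close>

text \<open>
  The eliminations below produce \<open>b - \<bar>\<mu>\<bar>\<^sup>2 Q P b\<close>, whereas the spectrum speaks of
  \<open>Q P b - b / \<bar>\<mu>\<bar>\<^sup>2\<close>.
\<close>
lemma norm_resolvent_rescale:
  fixes b y :: "'a::complex_inner"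
  assumes "c > 0"
  shows "norm (y - complex_of_real (1 / c) *\<^sub>C b) = 1 / c * norm (b - complex_of_real c *\<^sub>C y)"
proof -
  have "y - complex_of_real (1 / c) *\<^sub>C b
      = complex_of_real (- (1 / c)) *\<^sub>C (b - complex_of_real c *\<^sub>C y)"
    using assms by (simp add: complex_vector.scale_right_diff_distrib scaleC_scaleC scaleC_one)
  then show ?thesis using assms by (simp only: norm_scaleC norm_of_real) simp
qed

text \<open>
  Let \<open>P\<close> and \<open>Q\<close> be the projections onto \<open>M\<close> and \<open>N\<close>. Expanding the square, the coefficient of \<open>\<parallel>P x\<parallel>\<^sup>2\<close> and of \<open>\<parallel>Q x\<parallel>\<^sup>2\<close> is
  \<open>\<bar>\<mu>\<bar>\<^sup>2 - 2 Re \<mu> = \<bar>1 - \<mu>\<bar>\<^sup>2 - 1\<close>, which vanishes by the choice of the circle. The mixed term carries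
  \<open>\<mu> cnj (cnj \<mu>) = \<mu>\<^sup>2\<close>; taking conjugate coefficients for the two projections is what lets its
  argument be prescribed.
\<close>
lemma pencil_identity:
  fixes M N :: "'a::complex_hilbert_space set"
  assumes M: "closed_csubspace M" and N: "closed_csubspace N" and \<mu>: "norm (1 - \<mu>) = 1"
  shows "(norm (x - \<mu> *\<^sub>C orth_proj M x - cnj \<mu> *\<^sub>C orth_proj N x))\<^sup>2
    = (norm x)\<^sup>2 + 2 * Re (\<mu>\<^sup>2 * cinner (orth_proj N (orth_proj M x)) x)"
proof -
  define a b where "a = orth_proj M x" and "b = orth_proj N x"
  have ax: "cinner a x = cinner a a" "cinner x a = cinner a a"
    using cinner_orth_proj[OF M, of x x] orth_proj_self_adjoint[OF M, of x x] by (simp_all add: a_def)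
  have bx: "cinner b x = cinner b b" "cinner x b = cinner b b"
    using cinner_orth_proj[OF N, of x x] orth_proj_self_adjoint[OF N, of x x] by (simp_all add: b_def)
  have ba: "cinner b a = cnj (cinner a b)" by (rule cinner_commute)
  have ab: "cinner (orth_proj N a) x = cinner a b"
    by (simp add: b_def orth_proj_self_adjoint[OF N])
  have "(norm (1 - \<mu>))\<^sup>2 = 1" using \<mu> by simp
  then have \<mu>2: "(Re \<mu>)\<^sup>2 + (Im \<mu>)\<^sup>2 = 2 * Re \<mu>"
    unfolding cmod_power2 by (simp add: power2_eq_square algebra_simps)
  have "cinner (x - \<mu> *\<^sub>C a - cnj \<mu> *\<^sub>C b) (x - \<mu> *\<^sub>C a - cnj \<mu> *\<^sub>C b)
      = cinner x x + (\<mu> * cnj \<mu> - \<mu> - cnj \<mu>) * (cinner a a + cinner b b)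
        + (\<mu>\<^sup>2 * cinner a b + cnj (\<mu>\<^sup>2 * cinner a b))"
    by (simp add: cinner_add_left cinner_add_right cinner_diff_left cinner_diff_right
        cinner_scaleC_left cinner_scaleC_right ax bx ba algebra_simps power2_eq_square)
  moreover have "\<mu> * cnj \<mu> - \<mu> - cnj \<mu> = 0"
    using \<mu>2 by (simp add: complex_eq_iff power2_eq_square)
  ultimately have "cinner (x - \<mu> *\<^sub>C a - cnj \<mu> *\<^sub>C b) (x - \<mu> *\<^sub>C a - cnj \<mu> *\<^sub>C b)
      = cinner x x + (\<mu>\<^sup>2 * cinner a b + cnj (\<mu>\<^sup>2 * cinner a b))" by simp
  also have "\<dots> = cinner x x + complex_of_real (2 * Re (\<mu>\<^sup>2 * cinner a b))"
    by (simp only: complex_add_cnj)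
  finally show ?thesis
    unfolding norm_power2_eq_Re_cinner a_def[symmetric] b_def[symmetric] ab
    by (simp only: plus_complex.sel Re_complex_of_real)
qed

text \<open>
  Write \<open>a = P x\<close>, \<open>b = Q x\<close>, \<open>w = 1 - \<mu>\<close> and let \<open>e\<close> be the image of \<open>x\<close>. Projecting
  \<open>x = e + \<mu> a + cnj \<mu> b\<close> gives \<open>w a \<approx> cnj \<mu> P b\<close> and \<open>cnj w b \<approx> \<mu> Q a\<close> up to terms of size
  \<open>\<parallel>e\<parallel>\<close>. Eliminating \<open>a\<close> leaves \<open>b \<approx> \<bar>\<mu>\<bar>\<^sup>2 Q P b\<close>, because \<open>\<bar>w\<bar> = 1\<close>. A bounded inverse of
  \<open>Q P - 1 / \<bar>\<mu>\<bar>\<^sup>2\<close> thus bounds \<open>b\<close>, then \<open>a\<close>, then \<open>x\<close> by a multiple of \<open>\<parallel>e\<parallel>\<close>.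
\<close>
lemma pencil_bounded_below_if_not_in_spectrum:
  fixes M N :: "'a::complex_hilbert_space set"
  assumes M: "closed_csubspace M" and N: "closed_csubspace N" and \<mu>: "norm (1 - \<mu>) = 1" "\<mu> \<noteq> 0"
    and nin: "complex_of_real (1 / (norm \<mu>)\<^sup>2) \<notin> spectrum (orth_proj N \<circ> orth_proj M)"
  obtains \<delta> where "\<delta> > 0"
    "\<And>x. \<delta> * norm x \<le> norm (x - \<mu> *\<^sub>C orth_proj M x - cnj \<mu> *\<^sub>C orth_proj N x)"
proof -
  define P Q where "P = orth_proj M" and "Q = orth_proj N"
  define m where "m = norm \<mu>"
  define w where "w = 1 - \<mu>"
  have m: "m > 0" using \<mu>(2) by (simp add: m_def)
  have P: "bounded_clinear P" and Q: "bounded_clinear Q"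
    unfolding P_def Q_def by (intro bounded_clinear_orth_proj M N)+
  note lin = bounded_clinear_add[OF P] bounded_clinear_add[OF Q]
    bounded_clinear_diff[OF P] bounded_clinear_diff[OF Q]
    bounded_clinear_scaleC[OF P] bounded_clinear_scaleC[OF Q]
  have idem: "P (P x) = P x" "Q (Q x) = Q x" for x
    unfolding P_def Q_def by (rule orth_proj_idem[OF M] orth_proj_idem[OF N])+
  have contr: "norm (P x) \<le> norm x" "norm (Q x) \<le> norm x" for x
    unfolding P_def Q_def by (rule norm_orth_proj_le[OF M] norm_orth_proj_le[OF N])+
  have w: "norm w = 1" "w * cnj w = 1" "cnj w * w = 1"
    using \<mu>(1) complex_norm_square[of w] by (simp_all add: w_def mult.commute)
  have \<mu>\<mu>: "\<mu> * cnj \<mu> = complex_of_real (m\<^sup>2)"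
    unfolding m_def by (rule complex_norm_square[symmetric])
  obtain S where S: "bounded_clinear S"
    and SI: "\<And>y. S (Q (P y) - complex_of_real (1 / m\<^sup>2) *\<^sub>C y) = y"
    using nin unfolding spectrum_def P_def Q_def m_def by auto
  obtain K where K: "K \<ge> 0" "\<And>y. norm (S y) \<le> norm y * K"
    using S bounded_linear.nonneg_bounded unfolding bounded_clinear_def by blast
  \<comment> \<open>\<open>B\<close> will bound \<open>\<parallel>Q x\<parallel>\<close>, and \<open>D\<close> will bound \<open>\<parallel>x\<parallel>\<close>, relative to \<open>\<parallel>e\<parallel>\<close>.\<close>
  define B where "B = (1 + m) / m\<^sup>2 * K"
  have B: "B \<ge> 0" using K(1) m by (simp add: B_def)
  define D where "D = 1 + m * (1 + m * B) + m * B"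
  have D: "D > 0" using B m by (simp add: D_def add_pos_nonneg)
  have "norm x \<le> D * norm (x - \<mu> *\<^sub>C P x - cnj \<mu> *\<^sub>C Q x)" for x
  proof -
    define a b e where "a = P x" and "b = Q x" and "e = x - \<mu> *\<^sub>C P x - cnj \<mu> *\<^sub>C Q x"
    have xe: "x = e + \<mu> *\<^sub>C a + cnj \<mu> *\<^sub>C b" by (simp add: a_def b_def e_def)
    have Pe: "P e + cnj \<mu> *\<^sub>C P b = w *\<^sub>C a"
      by (simp add: e_def a_def b_def w_def lin idem complex_vector.scale_left_diff_distrib)
    have Qe: "\<mu> *\<^sub>C Q a = cnj w *\<^sub>C b - Q e"
      by (simp add: e_def a_def b_def w_def lin idem complex_vector.scale_left_diff_distrib)
    have "norm a = norm (P e + cnj \<mu> *\<^sub>C P b)" unfolding Pe norm_scaleC w(1) by simp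
    also have "\<dots> \<le> norm (P e) + m * norm (P b)"
      by (rule norm_triangle_le) (simp add: norm_scaleC m_def)
    also have "\<dots> \<le> norm e + m * norm b"
      using contr m by (intro add_mono mult_left_mono) auto
    finally have na: "norm a \<le> norm e + m * norm b" .
    have "cnj \<mu> *\<^sub>C Q (P b) = w *\<^sub>C Q a - Q (P e)"
      using arg_cong[OF Pe, of Q] by (simp add: lin algebra_simps)
    from arg_cong[OF this, of "scaleC \<mu>"]
    have "complex_of_real (m\<^sup>2) *\<^sub>C Q (P b) = w *\<^sub>C (\<mu> *\<^sub>C Q a) - \<mu> *\<^sub>C Q (P e)"
      by (simp add: scaleC_scaleC \<mu>\<mu> complex_vector.scale_right_diff_distrib mult.commute)
    also have "\<dots> = b - (w *\<^sub>C Q e + \<mu> *\<^sub>C Q (P e))"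
      unfolding Qe complex_vector.scale_right_diff_distrib scaleC_scaleC w(2) by (simp add: scaleC_one)
    finally have eq: "b - complex_of_real (m\<^sup>2) *\<^sub>C Q (P b) = w *\<^sub>C Q e + \<mu> *\<^sub>C Q (P e)" by simp
    have "norm (b - complex_of_real (m\<^sup>2) *\<^sub>C Q (P b)) \<le> norm (Q e) + m * norm (Q (P e))"
      unfolding eq by (rule norm_triangle_le) (simp add: norm_scaleC m_def w(1))
    also have "\<dots> \<le> norm e + m * norm e"
      using contr m order_trans[OF contr(2) contr(1)] by (intro add_mono mult_left_mono) auto
    finally have r: "norm (b - complex_of_real (m\<^sup>2) *\<^sub>C Q (P b)) \<le> (1 + m) * norm e"
      by (simp add: algebra_simps)
    have "norm b \<le> norm (Q (P b) - complex_of_real (1 / m\<^sup>2) *\<^sub>C b) * K"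
      using K(2)[of "Q (P b) - complex_of_real (1 / m\<^sup>2) *\<^sub>C b"] unfolding SI .
    also have "norm (Q (P b) - complex_of_real (1 / m\<^sup>2) *\<^sub>C b)
        = 1 / m\<^sup>2 * norm (b - complex_of_real (m\<^sup>2) *\<^sub>C Q (P b))"
      by (rule norm_resolvent_rescale) (use m in simp)
    also have "\<dots> * K \<le> 1 / m\<^sup>2 * ((1 + m) * norm e) * K"
      using r K(1) by (intro mult_right_mono mult_left_mono) auto
    finally have nb: "norm b \<le> B * norm e" by (simp add: B_def mult_ac)
    have "norm x \<le> norm e + m * norm a + m * norm b"
      using norm_triangle_ineq[of "e + \<mu> *\<^sub>C a" "cnj \<mu> *\<^sub>C b"] norm_triangle_ineq[of e "\<mu> *\<^sub>C a"]
      by (simp add: xe[symmetric] norm_scaleC m_def)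
    also have "\<dots> \<le> norm e + m * (norm e + m * (B * norm e)) + m * (B * norm e)"
      using na nb m by (intro add_mono mult_left_mono order_refl order_trans[OF na]) auto
    also have "\<dots> = D * norm e" by (simp add: D_def algebra_simps)
    finally show ?thesis by (simp add: e_def)
  qed
  then show thesis
    using D by (intro that[of "1 / D"]) (simp_all add: P_def Q_def field_simps)
qed

text \<open>
  For \<open>b\<close> in \<open>N\<close> there is a vector \<open>x\<close> on which the elimination of the previous lemma can be run
  backwards: its image under the pencil is a unimodular multiple of \<open>cnj \<mu> (b - \<bar>\<mu>\<bar>\<^sup>2 Q P b)\<close>. So the
  lower bound for the pencil bounds \<open>Q P - 1 / \<bar>\<mu>\<bar>\<^sup>2\<close> from below on \<open>N\<close>. There, \<open>Q P\<close> agrees with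
  the self-adjoint \<open>Q P Q\<close>, so this is enough for invertibility.
\<close>
lemma not_in_spectrum_if_pencil_bounded_below:
  fixes M N :: "'a::complex_hilbert_space set"
  assumes M: "closed_csubspace M" and N: "closed_csubspace N" and \<mu>: "norm (1 - \<mu>) = 1" "\<mu> \<noteq> 0"
    and \<delta>: "\<delta> > 0"
      "\<And>x. \<delta> * norm x \<le> norm (x - \<mu> *\<^sub>C orth_proj M x - cnj \<mu> *\<^sub>C orth_proj N x)"
  shows "complex_of_real (1 / (norm \<mu>)\<^sup>2) \<notin> spectrum (orth_proj N \<circ> orth_proj M)"
proof -
  define P Q where "P = orth_proj M" and "Q = orth_proj N"
  define m where "m = norm \<mu>"
  define l where "l = 1 / m\<^sup>2"
  define w where "w = 1 - \<mu>"
  have m: "m > 0" using \<mu>(2) by (simp add: m_def)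
  have l: "l > 0" using m by (simp add: l_def)
  have P: "bounded_clinear P" and Q: "bounded_clinear Q"
    unfolding P_def Q_def by (intro bounded_clinear_orth_proj M N)+
  note lin = bounded_clinear_add[OF P] bounded_clinear_add[OF Q]
    bounded_clinear_diff[OF P] bounded_clinear_diff[OF Q]
    bounded_clinear_scaleC[OF P] bounded_clinear_scaleC[OF Q]
  have idem: "P (P x) = P x" "Q (Q x) = Q x" for x
    unfolding P_def Q_def by (rule orth_proj_idem[OF M] orth_proj_idem[OF N])+
  have w: "norm w = 1" "w * cnj w = 1"
    using \<mu>(1) complex_norm_square[of w] by (simp_all add: w_def)
  have \<mu>\<mu>: "\<mu> * cnj \<mu> = complex_of_real (m\<^sup>2)"
    unfolding m_def by (rule complex_norm_square[symmetric])
  define \<epsilon> where "\<epsilon> = l / (1 + m / \<delta>)"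
  have \<epsilon>: "\<epsilon> > 0" "\<epsilon> \<le> l"
    using l m \<delta>(1) by (simp_all add: \<epsilon>_def add_pos_nonneg field_simps)
  have below: "\<epsilon> * norm b \<le> norm (Q (P b) - complex_of_real l *\<^sub>C b)" if b: "Q b = b" for b
  proof -
    \<comment> \<open>The choice of \<open>a\<close> solves \<open>w a = cnj \<mu> P b\<close>, so that \<open>P x = a\<close> holds exactly; the whole error
      then sits in \<open>Q x - b\<close>.\<close>
    define a where "a = (cnj \<mu> * cnj w) *\<^sub>C P b"
    define x where "x = \<mu> *\<^sub>C a + cnj \<mu> *\<^sub>C b"
    define r where "r = b - complex_of_real (m\<^sup>2) *\<^sub>C Q (P b)"
    have "w *\<^sub>C a = cnj \<mu> *\<^sub>C P b"
      unfolding a_def scaleC_scaleC using w(2) by (simp add: mult.left_commute)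
    then have "cnj \<mu> *\<^sub>C P b = a - \<mu> *\<^sub>C a"
      by (simp add: w_def complex_vector.scale_left_diff_distrib)
    moreover have "P a = a" by (simp add: a_def lin idem)
    ultimately have Px: "P x = a" by (simp add: x_def lin)
    have "\<mu> *\<^sub>C Q a = cnj w *\<^sub>C (complex_of_real (m\<^sup>2) *\<^sub>C Q (P b))"
      unfolding a_def lin scaleC_scaleC \<mu>\<mu>[symmetric] by (simp add: mult_ac)
    then have Qx: "Q x = b - cnj w *\<^sub>C r"
      by (simp add: x_def r_def lin b w_def complex_vector.scale_left_diff_distrib
          complex_vector.scale_right_diff_distrib)
    have "x - \<mu> *\<^sub>C P x - cnj \<mu> *\<^sub>C Q x = (cnj \<mu> * cnj w) *\<^sub>C r"
      unfolding Px Qx by (simp add: x_def complex_vector.scale_right_diff_distrib scaleC_scaleC)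
    then have "\<delta> * norm x \<le> m * norm r"
      using \<delta>(2)[of x] w(1) by (simp add: P_def Q_def norm_scaleC norm_mult m_def)
    then have nx: "norm x \<le> m / \<delta> * norm r" using \<delta>(1) by (simp add: field_simps)
    have "norm b = norm (Q x + cnj w *\<^sub>C r)" by (simp add: Qx)
    also have "\<dots> \<le> norm (Q x) + norm r"
      by (rule norm_triangle_le) (simp add: norm_scaleC w(1))
    also have "norm (Q x) \<le> norm x" unfolding Q_def by (rule norm_orth_proj_le[OF N])
    finally have nb: "norm b \<le> (1 + m / \<delta>) * norm r" using nx by (simp add: algebra_simps)
    have c: "1 + m / \<delta> > 0" using m \<delta>(1) by (simp add: add_pos_pos)
    have "\<epsilon> * norm b \<le> \<epsilon> * ((1 + m / \<delta>) * norm r)"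
      using nb \<epsilon>(1) by (intro mult_left_mono) auto
    also have "\<dots> = l * norm r" using c by (simp add: \<epsilon>_def)
    also have "\<dots> = norm (Q (P b) - complex_of_real l *\<^sub>C b)"
      unfolding r_def l_def by (rule norm_resolvent_rescale[symmetric]) (use m in simp)
    finally show ?thesis .
  qed
  \<comment> \<open>On \<open>N\<close> this is \<open>Q P - l\<close>, and on the orthogonal complement it is \<open>- l\<close>.\<close>
  define C where "C = (\<lambda>y. Q (P (Q y)) - complex_of_real l *\<^sub>C y)"
  have C: "bounded_clinear C"
    unfolding C_def
    by (intro bounded_clinear_sub bounded_clinear_scale bounded_clinear_ident
        bounded_clinear_compose[OF Q] bounded_clinear_compose[OF P] Q)
  have adj: "cinner (C x) y = cinner x (C y)" for x y
    by (simp add: C_def P_def Q_def cinner_diff_left cinner_diff_right cinner_scaleC_left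
        cinner_scaleC_right orth_proj_self_adjoint[OF M] orth_proj_self_adjoint[OF N])
  have C_below: "\<epsilon> * norm y \<le> norm (C y)" for y
  proof (rule power2_le_imp_le)
    have QC: "Q (C y) = Q (P (Q y)) - complex_of_real l *\<^sub>C Q y"
      by (simp add: C_def lin idem)
    have rest: "C y - Q (C y) = - complex_of_real l *\<^sub>C (y - Q y)"
      unfolding QC by (simp add: C_def complex_vector.scale_right_diff_distrib)
    have "(\<epsilon> * norm y)\<^sup>2 = (\<epsilon> * norm (Q y))\<^sup>2 + (\<epsilon> * norm (y - Q y))\<^sup>2"
      unfolding power_mult_distrib norm_orth_proj_pythagoras[OF N, of y] Q_def
      by (simp add: algebra_simps)
    also have "\<dots> \<le> (norm (Q (C y)))\<^sup>2 + (norm (C y - Q (C y)))\<^sup>2"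
    proof (intro add_mono power_mono)
      show "\<epsilon> * norm (Q y) \<le> norm (Q (C y))" unfolding QC by (intro below idem)
      show "\<epsilon> * norm (y - Q y) \<le> norm (C y - Q (C y))"
        unfolding rest norm_scaleC using \<epsilon>(2) l by (auto intro!: mult_right_mono)
    qed (use \<epsilon>(1) in auto)
    also have "\<dots> = (norm (C y))\<^sup>2"
      unfolding Q_def by (rule norm_orth_proj_pythagoras[OF N, symmetric])
    finally show "(\<epsilon> * norm y)\<^sup>2 \<le> (norm (C y))\<^sup>2" .
  qed simp
  obtain R where R: "bounded_clinear R" and RC: "\<And>x. R (C x) = x" and CR: "\<And>x. C (R x) = x"
    using self_adjoint_bounded_below_invertible[OF C adj \<epsilon>(1) C_below] by blast
  \<comment> \<open>If \<open>B A - l\<close> has inverse \<open>R\<close>, then \<open>A B - l\<close> has inverse \<open>(A R B - 1) / l\<close>; here \<open>A = Q\<close> and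
    \<open>B = Q P\<close>, so that \<open>B A = Q P Q\<close> and \<open>A B = Q P\<close>.\<close>
  define S where "S = (\<lambda>x. complex_of_real (1 / l) *\<^sub>C (Q (R (Q (P x))) - x))"
  have S: "bounded_clinear S"
    unfolding S_def
    by (intro bounded_clinear_scale bounded_clinear_sub bounded_clinear_ident
        bounded_clinear_compose[OF Q] bounded_clinear_compose[OF R] bounded_clinear_compose[OF Q] P)
  have ll: "complex_of_real (1 / l) *\<^sub>C (complex_of_real l *\<^sub>C x) = x" for x :: 'a
    using l by (simp add: scaleC_scaleC scaleC_one)
  have "S (Q (P x) - complex_of_real l *\<^sub>C x) = x" for x
  proof -
    have "Q (P (Q (P x) - complex_of_real l *\<^sub>C x)) = C (Q (P x))"
      by (simp add: C_def lin idem)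
    then have "S (Q (P x) - complex_of_real l *\<^sub>C x)
        = complex_of_real (1 / l) *\<^sub>C (complex_of_real l *\<^sub>C x)"
      unfolding S_def by (simp add: RC idem)
    then show ?thesis by (simp only: ll)
  qed
  moreover have "Q (P (S x)) - complex_of_real l *\<^sub>C S x = x" for x
  proof -
    define v where "v = Q (R (Q (P x)))"
    have "Q (P v) = Q (P x) + complex_of_real l *\<^sub>C v"
      using arg_cong[OF CR[of "Q (P x)"], of Q] by (simp add: v_def C_def lin idem algebra_simps)
    then have "Q (P (v - x)) - complex_of_real l *\<^sub>C (v - x) = complex_of_real l *\<^sub>C x"
      by (simp add: lin complex_vector.scale_right_diff_distrib)
    from arg_cong[OF this, of "scaleC (complex_of_real (1 / l))"]
    show ?thesis
      unfolding ll S_def v_def[symmetric] lin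
      by (simp only: complex_vector.scale_right_diff_distrib complex_vector.scale_left_commute)
  qed
  ultimately show ?thesis
    using S unfolding spectrum_def l_def m_def P_def Q_def by auto
qed

theorem theorem1p6:
  fixes M\<^sub>1 M\<^sub>2 :: "'a::complex_hilbert_space set" and \<alpha> :: real
  assumes "(UNIV :: 'a set) \<noteq> {0}"
    and "closed_csubspace M\<^sub>1" and "closed_csubspace M\<^sub>2"
    and "pi / 3 \<le> \<alpha>" and "\<alpha> \<le> pi"
  shows "complex_of_real (1 / (2 * (1 - cos \<alpha>))) \<in> spectrum (orth_proj M\<^sub>2 \<circ> orth_proj M\<^sub>1)
    \<longleftrightarrow> (SUP z \<in> numerical_range (orth_proj M\<^sub>2 \<circ> orth_proj M\<^sub>1). Re (z * exp (- \<i> * complex_of_real \<alpha>)))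
        = 1 / (4 * (1 - cos \<alpha>))"
proof -
  note M1 = assms(2) and M2 = assms(3)
  define T where "T = orth_proj M\<^sub>2 \<circ> orth_proj M\<^sub>1"
  define \<mu> where "\<mu> = 1 - cis (- \<alpha>)"
  define k where "k = 2 * (1 - cos \<alpha>)"
  define f where "f = (\<lambda>z. Re (z * exp (- \<i> * complex_of_real \<alpha>)))"
  define W where "W = numerical_range T"
  have "cos \<alpha> \<le> cos (pi / 3)"
    using assms(4,5) by (intro cos_monotone_0_pi_le) auto
  then have k: "k > 0" by (simp add: k_def cos_60)
  have unit: "norm (1 - \<mu>) = 1" by (simp add: \<mu>_def)
  have norm_\<mu>: "(norm \<mu>)\<^sup>2 = k"
    using sin_cos_squared_add[of \<alpha>]
    unfolding \<mu>_def k_def cmod_power2 by (simp add: power2_eq_square algebra_simps)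
  have \<mu>0: "\<mu> \<noteq> 0" using norm_\<mu> k by auto
  have \<mu>2: "\<mu>\<^sup>2 = - complex_of_real k * exp (- \<i> * complex_of_real \<alpha>)"
  proof -
    have "exp (- \<i> * complex_of_real \<alpha>) = cis (- \<alpha>)" by (simp add: cis_conv_exp)
    then show ?thesis
      using sin_cos_squared_add[of \<alpha>]
      by (simp add: \<mu>_def k_def complex_eq_iff power2_eq_square algebra_simps)
  qed
  have pencil: "(norm (x - \<mu> *\<^sub>C orth_proj M\<^sub>1 x - cnj \<mu> *\<^sub>C orth_proj M\<^sub>2 x))\<^sup>2
      = (norm x)\<^sup>2 - 2 * k * f (cinner (T x) x)" for x
    unfolding pencil_identity[OF M1 M2 unit] \<mu>2 f_def T_def by (simp add: algebra_simps)
  have T_scale: "T (c *\<^sub>C x) = c *\<^sub>C T x" for c x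
    unfolding T_def
    by (simp add: bounded_clinear_scaleC bounded_clinear_orth_proj M1 M2)
  obtain x0 :: 'a where "x0 \<noteq> 0" using assms(1) by auto
  then have "norm (complex_of_real (1 / norm x0) *\<^sub>C x0) = 1" by (simp add: norm_scaleC norm_divide)
  then have ne: "W \<noteq> {}" unfolding W_def numerical_range_def by blast
  have f_le: "f z \<le> 1 / (2 * k)" if z: "z \<in> W" for z
  proof -
    obtain x where x: "norm x = 1" "z = cinner (T x) x"
      using z unfolding W_def numerical_range_def by auto
    then have "0 \<le> 1 - 2 * k * f z" using pencil[of x] by (metis power_one zero_le_power2)
    then show ?thesis using k by (simp add: field_simps)
  qed
  have bdd: "bdd_above (f ` W)" using f_le by (rule bdd_aboveI2)
  have sup_le: "(SUP z\<in>W. f z) \<le> 1 / (2 * k)" using ne f_le by (rule cSUP_least)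
  have "complex_of_real (1 / k) \<in> spectrum T \<longleftrightarrow> (SUP z\<in>W. f z) = 1 / (2 * k)"
  proof
    assume spec: "complex_of_real (1 / k) \<in> spectrum T"
    show "(SUP z\<in>W. f z) = 1 / (2 * k)"
    proof (rule ccontr)
      assume "(SUP z\<in>W. f z) \<noteq> 1 / (2 * k)"
      with sup_le have lt: "(SUP z\<in>W. f z) < 1 / (2 * k)" by simp
      \<comment> \<open>The pencil identity turns a supremum short of the maximal value into the lower bound
        \<open>\<eta>\<close> for the squared norm of the pencil on unit vectors.\<close>
      define \<eta> where "\<eta> = 1 - 2 * k * (SUP z\<in>W. f z)"
      have \<eta>: "\<eta> > 0" using lt k by (simp add: \<eta>_def field_simps)
      have "sqrt \<eta> * norm x \<le> norm (x - \<mu> *\<^sub>C orth_proj M\<^sub>1 x - cnj \<mu> *\<^sub>C orth_proj M\<^sub>2 x)" for x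
      proof (rule power2_le_imp_le)
        have f_quad: "f (cinner (T x) x) \<le> (SUP z\<in>W. f z) * (norm x)\<^sup>2"
        proof (cases "x = 0")
          case True
          then show ?thesis by (simp add: f_def)
        next
          case False
          define u where "u = complex_of_real (1 / norm x) *\<^sub>C x"
          have "norm u = 1" using False by (simp add: u_def norm_scaleC norm_divide)
          then have "cinner (T u) u \<in> W" unfolding W_def numerical_range_def by blast
          then have "f (cinner (T u) u) \<le> (SUP z\<in>W. f z)" using bdd by (rule cSUP_upper)
          moreover have "f (cinner (T u) u) = f (cinner (T x) x) / (norm x)\<^sup>2"
            unfolding u_def T_scale cinner_scaleC_left cinner_scaleC_right f_def
            by (simp add: power2_eq_square field_simps)
          ultimately show ?thesis using False by (simp add: field_simps)
        qed
        have "(sqrt \<eta> * norm x)\<^sup>2 = (norm x)\<^sup>2 - 2 * k * ((SUP z\<in>W. f z) * (norm x)\<^sup>2)"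
          using \<eta> by (simp add: power_mult_distrib \<eta>_def algebra_simps)
        also have "\<dots> \<le> (norm x)\<^sup>2 - 2 * k * f (cinner (T x) x)"
          using f_quad k by simp
        finally show "(sqrt \<eta> * norm x)\<^sup>2
            \<le> (norm (x - \<mu> *\<^sub>C orth_proj M\<^sub>1 x - cnj \<mu> *\<^sub>C orth_proj M\<^sub>2 x))\<^sup>2"
          unfolding pencil .
      qed simp
      then have "complex_of_real (1 / k) \<notin> spectrum T"
        using not_in_spectrum_if_pencil_bounded_below[OF M1 M2 unit \<mu>0, of "sqrt \<eta>"] \<eta>
        by (simp add: norm_\<mu> T_def)
      with spec show False by contradiction
    qed
  next
    assume sup: "(SUP z\<in>W. f z) = 1 / (2 * k)"
    show "complex_of_real (1 / k) \<in> spectrum T"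
    proof (rule ccontr)
      assume "complex_of_real (1 / k) \<notin> spectrum T"
      then obtain \<delta> where \<delta>: "\<delta> > 0"
        "\<And>x. \<delta> * norm x \<le> norm (x - \<mu> *\<^sub>C orth_proj M\<^sub>1 x - cnj \<mu> *\<^sub>C orth_proj M\<^sub>2 x)"
        using pencil_bounded_below_if_not_in_spectrum[OF M1 M2 unit \<mu>0] norm_\<mu>
        unfolding T_def by metis
      have "f z \<le> (1 - \<delta>\<^sup>2) / (2 * k)" if z: "z \<in> W" for z
      proof -
        obtain x where x: "norm x = 1" "z = cinner (T x) x"
          using z unfolding W_def numerical_range_def by auto
        have "\<delta>\<^sup>2 \<le> (norm (x - \<mu> *\<^sub>C orth_proj M\<^sub>1 x - cnj \<mu> *\<^sub>C orth_proj M\<^sub>2 x))\<^sup>2"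
          using \<delta>(1) \<delta>(2)[of x] x(1) by (intro power_mono) auto
        then have "\<delta>\<^sup>2 \<le> 1 - 2 * k * f z" unfolding pencil x by simp
        then show ?thesis using k by (simp add: field_simps)
      qed
      with ne have "(SUP z\<in>W. f z) \<le> (1 - \<delta>\<^sup>2) / (2 * k)" by (rule cSUP_least)
      also have "\<dots> < 1 / (2 * k)" using \<delta>(1) k by (intro divide_strict_right_mono) auto
      finally show False using sup by simp
    qed
  qed
  then show ?thesis by (simp add: T_def W_def f_def k_def)
qed

end
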